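(* Let $V$ be a discrete valuation domain of characteristic $2$ with uniformizer $\pi$ and infinite residue field $L=V/\pi V$, let $K=\operatorname{Frac}(V)$, and let $D=\mathbb F_2+\pi V=\{x\in V: x\bmod\pi V\in\mathbb F_2\}$. Let $U,W$ be algebraically independent over $K$, and let $A=\bigcup_{r\ge0}A_r\subseteq K[U,W]$ be the ring obtained from $D[U,W]$ by iterated closure under substitution into integer-valued polynomials of $D$ (defined in the context). Then the polynomial $$P(U,W)=\frac{(U^2+U)(W^2+W)}{\pi}\in K[U,W]$$ belongs to $\operatorname{Int}(D^2)$ but not to $A$.
   Context: The quotient field of $D$ is $K$. $\operatorname{Int}(D)=\{f\in K[Z]: f(D)\subseteq D\}$ and $\operatorname{Int}(D^2)=\{F\in K[U,W]: F(D^2)\subseteq D\}$. The rings $A_r$ are defined recursively by $A_0=D[U,W]$ and $A_{r+1}=D\big[A_r,\ f(G) : f\in\operatorname{Int}(D),\ G\in A_r\big]$, i.e. the $D$-subalgebra of $K[U,W]$ generated by $A_r$ and all the polynomials $f(G)$ with $f\in\operatorname{Int}(D)$, $G\in A_r$. All $A_r$ are contained in $\operatorname{Int}(D^2)$, the sequence is ascending, and $A=\bigcup_{r\ge0}A_r$. *)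

theory Defs
  imports "HOL-Computational_Algebra.Polynomial"
begin

text \<open>A discrete valuation on the field, normalised to have value group \<open>\<int>\<close>. The value
  \<open>v 0\<close> is left unspecified; \<open>0\<close> is treated separately wherever \<open>v\<close> is used.\<close>

definition discrete_valuation :: "('k::field \<Rightarrow> int) \<Rightarrow> bool" where
  "discrete_valuation v \<longleftrightarrow>
     (\<forall>x y. x \<noteq> 0 \<longrightarrow> y \<noteq> 0 \<longrightarrow> v (x * y) = v x + v y) \<and>
     (\<forall>x y. x \<noteq> 0 \<longrightarrow> y \<noteq> 0 \<longrightarrow> x + y \<noteq> 0 \<longrightarrow> min (v x) (v y) \<le> v (x + y)) \<and>
     v ` (UNIV - {0}) = UNIV"

text \<open>\<open>V\<close> is a discrete valuation domain whose field of fractions is the whole type \<open>'k\<close>;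
  see \<open>dvr_fractions\<close> below for the latter.\<close>

definition discrete_valuation_domain :: "'k::field set \<Rightarrow> bool" where
  "discrete_valuation_domain V \<longleftrightarrow>
     (\<exists>v. discrete_valuation v \<and> V = {x. x = 0 \<or> 0 \<le> v x})"

text \<open>A generator of the maximal ideal, which consists of the non-units of \<open>V\<close>
  (\<open>inverse 0 = 0\<close>, hence the separate mention of \<open>0\<close>).\<close>

definition uniformizer :: "'k::field set \<Rightarrow> 'k \<Rightarrow> bool" where
  "uniformizer V p \<longleftrightarrow> p \<in> V \<and> {x \<in> V. x = 0 \<or> inverse x \<notin> V} = {p * y | y. y \<in> V}"

definition residue_field :: "'k::field set \<Rightarrow> 'k \<Rightarrow> 'k set set" where
  "residue_field V p = V // {(x, y). x \<in> V \<and> y \<in> V \<and> x - y \<in> {p * z | z. z \<in> V}}"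

text \<open>In characteristic 2 the prime field is \<open>{0, 1}\<close>, so this is \<open>\<bbbF>\<^sub>2 + p V\<close>.\<close>

definition F2_plus :: "'k::field set \<Rightarrow> 'k \<Rightarrow> 'k set" where
  "F2_plus V p = {e + p * y | e y. e \<in> {0, 1} \<and> y \<in> V}"

text \<open>The ring \<open>K[U,W]\<close> is \<open>'k poly poly\<close>, with \<open>U\<close> the inner and \<open>W\<close> the outer variable.\<close>

definition const2 :: "'k::field \<Rightarrow> 'k poly poly" where
  "const2 c = [:[:c:]:]"

definition varU :: "'k::field poly poly" where
  "varU = [:[:0, 1:]:]"

definition varW :: "'k::field poly poly" where
  "varW = [:0, 1:]"

definition eval2 :: "'k::field poly poly \<Rightarrow> 'k \<Rightarrow> 'k \<Rightarrow> 'k" where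
  "eval2 F u w = poly (poly F [:w:]) u"

text \<open>\<open>f(G)\<close> for \<open>f \<in> K[Z]\<close> and \<open>G \<in> K[U,W]\<close>.\<close>

definition subst2 :: "'k::field poly \<Rightarrow> 'k poly poly \<Rightarrow> 'k poly poly" where
  "subst2 f G = poly (map_poly const2 f) G"

text \<open>In the next two definitions the polynomials have coefficients in \<open>'k\<close>, so they give
  \<open>Int(D)\<close> and \<open>Int(D\<^sup>2)\<close> when \<open>'k\<close> is the quotient field of \<open>D\<close>. For \<open>D = \<bbbF>\<^sub>2 + p V\<close> this
  is \<open>F2_plus_fractions\<close> below.\<close>

definition Int1 :: "'k::field set \<Rightarrow> 'k poly set" where
  "Int1 D = {f. \<forall>x\<in>D. poly f x \<in> D}"

definition Int2 :: "'k::field set \<Rightarrow> 'k poly poly set" where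
  "Int2 D = {F. \<forall>u\<in>D. \<forall>w\<in>D. eval2 F u w \<in> D}"

text \<open>The \<open>D\<close>-subalgebra \<open>D[S]\<close> of \<open>K[U,W]\<close> generated by \<open>S\<close>.\<close>

inductive_set adjoin :: "'k::field set \<Rightarrow> 'k poly poly set \<Rightarrow> 'k poly poly set"
  for D S where
  const: "c \<in> D \<Longrightarrow> const2 c \<in> adjoin D S"
| gen: "F \<in> S \<Longrightarrow> F \<in> adjoin D S"
| diff: "F \<in> adjoin D S \<Longrightarrow> G \<in> adjoin D S \<Longrightarrow> F - G \<in> adjoin D S"
| mult: "F \<in> adjoin D S \<Longrightarrow> G \<in> adjoin D S \<Longrightarrow> F * G \<in> adjoin D S"

primrec A_ring :: "'k::field set \<Rightarrow> nat \<Rightarrow> 'k poly poly set" where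
  "A_ring D 0 = adjoin D {varU, varW}"
| "A_ring D (Suc r) =
     adjoin D (A_ring D r \<union> {subst2 f G | f G. f \<in> Int1 D \<and> G \<in> A_ring D r})"

definition A_union :: "'k::field set \<Rightarrow> 'k poly poly set" where
  "A_union D = (\<Union>r. A_ring D r)"

lemma dvr_fractions:
  assumes "discrete_valuation_domain V"
  shows "\<exists>a\<in>V. \<exists>b\<in>V. b \<noteq> 0 \<and> x = a / b"
proof -
  obtain v where v: "discrete_valuation v" and V: "V = {x. x = 0 \<or> 0 \<le> v x}"
    using assms by (auto simp: discrete_valuation_domain_def)
  have mult: "v (a * b) = v a + v b" if "a \<noteq> 0" "b \<noteq> 0" for a b
    using v that by (auto simp: discrete_valuation_def)
  have "v 1 = 0"
    using mult[of 1 1] by simp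
  show ?thesis
  proof (cases "x \<in> V")
    case True
    have "1 \<in> V" using \<open>v 1 = 0\<close> by (simp add: V)
    with True show ?thesis by (intro bexI[of _ x] bexI[of _ 1]) auto
  next
    case False
    hence "x \<noteq> 0" "v x < 0" by (auto simp: V)
    moreover have "v x + v (inverse x) = 0"
      using mult[of x "inverse x"] \<open>v 1 = 0\<close> \<open>x \<noteq> 0\<close> by simp
    ultimately have "inverse x \<in> V" "1 \<in> V" using \<open>v 1 = 0\<close> by (auto simp: V)
    with \<open>x \<noteq> 0\<close> show ?thesis
      by (intro bexI[of _ 1] bexI[of _ "inverse x"]) (auto simp: field_simps)
  qed
qed

lemma F2_plus_fractions:
  assumes "discrete_valuation_domain V" "uniformizer V p"
  shows "\<exists>a\<in>F2_plus V p. \<exists>b\<in>F2_plus V p. b \<noteq> 0 \<and> x = a / b"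
proof -
  obtain v where v: "discrete_valuation v" and V: "V = {x. x = 0 \<or> 0 \<le> v x}"
    using assms by (auto simp: discrete_valuation_domain_def)
  have mult: "v (a * b) = v a + v b" if "a \<noteq> 0" "b \<noteq> 0" for a b
    using v that by (auto simp: discrete_valuation_def)
  have "1 \<in> v ` (UNIV - {0})"
    using v by (auto simp: discrete_valuation_def)
  then obtain t where t: "t \<noteq> 0" "v t = 1" by (metis DiffE imageE singletonI)
  have "v 1 = 0"
    using mult[of 1 1] by simp
  hence "v t + v (inverse t) = 0"
    using mult[of t "inverse t"] t by simp
  hence "t \<in> {x \<in> V. x = 0 \<or> inverse x \<notin> V}"
    using t by (auto simp: V)
  hence "p \<noteq> 0" using assms(2) t(1) by (auto simp: uniformizer_def)
  obtain a b where "a \<in> V" "b \<in> V" "b \<noteq> 0" "x = a / b"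
    using dvr_fractions[OF assms(1), of x] by auto
  moreover have "p * y \<in> F2_plus V p" if "y \<in> V" for y
    unfolding F2_plus_def using that by (intro CollectI exI[of _ 0] exI[of _ y]) auto
  ultimately have "p * a \<in> F2_plus V p" "p * b \<in> F2_plus V p" "p * b \<noteq> 0"
      "x = (p * a) / (p * b)"
    using \<open>p \<noteq> 0\<close> by auto
  thus ?thesis by blast
qed

end

theory Submission
  imports Defs
begin

text \<open>
  \<open>P\<close> is integer-valued because \<open>u\<^sup>2 + u \<in> p V\<close> for every \<open>u \<in> D\<close>. That it does not lie in \<open>A\<close> is
  seen on the Taylor expansion at the origin up to the mixed term:
  \<open>F = F\<^sub>0\<^sub>0 + F\<^sub>1\<^sub>0 U + F\<^sub>0\<^sub>1 W + F\<^sub>1\<^sub>1 U W + \<dots>\<close>. Consider the polynomials \<open>F\<close> with \<open>F\<^sub>0\<^sub>0 \<in> D\<close> and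
  \<open>F\<^sub>1\<^sub>0, F\<^sub>0\<^sub>1, F\<^sub>1\<^sub>1 \<in> V\<close>. By Leibniz they form a ring, which contains \<open>D[U,W]\<close>. This ring is also
  closed under substitution into \<open>f \<in> Int(D)\<close>: the chain rule gives
  \<open>f(G)\<^sub>1\<^sub>1 = f'(G\<^sub>0\<^sub>0) G\<^sub>1\<^sub>1 + f''(G\<^sub>0\<^sub>0) G\<^sub>1\<^sub>0 G\<^sub>0\<^sub>1\<close>, and in characteristic 2 the second derivative is
  zero. (The values of the Hasse derivative \<open>f''/2\<close> need not lie in \<open>V\<close>, but in degree 2 it enters
  the coefficients of \<open>U\<^sup>2\<close> and \<open>W\<^sup>2\<close> only.) Hence all that is needed is \<open>f'(D) \<subseteq> V\<close>, which is
  \<open>pderiv_Int1_in_V\<close>. So \<open>A\<close> lies in this ring (\<open>A_union_subset_Vjets\<close>), whereas \<open>P\<^sub>1\<^sub>1 = 1/p\<close> is not in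
  \<open>V\<close>.

  For \<open>f'(D) \<subseteq> V\<close>, note that \<open>f\<^sup>2 + f\<close> maps \<open>D\<close> into \<open>p V\<close>, so \<open>y \<mapsto> (f\<^sup>2 + f)(d + p y)\<close> maps \<open>V\<close>
  into \<open>p V\<close>. As the residue field is infinite, a polynomial doing so has all its coefficients in
  \<open>p V\<close> (\<open>coeff_in_submodule\<close>). Its linear coefficient is \<open>p (f\<^sup>2 + f)'(d) = p f'(d)\<close>.
\<close>

lemma dvr_closed:
  assumes "discrete_valuation_domain V"
  shows "0 \<in> V" "1 \<in> V" "x \<in> V \<Longrightarrow> y \<in> V \<Longrightarrow> x * y \<in> V"
    "x \<in> V \<Longrightarrow> y \<in> V \<Longrightarrow> x - y \<in> V" "x \<in> V \<Longrightarrow> y \<in> V \<Longrightarrow> x + y \<in> V"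
proof -
  obtain v where v: "discrete_valuation v" and V: "V = {x. x = 0 \<or> 0 \<le> v x}"
    using assms by (auto simp: discrete_valuation_domain_def)
  have mult: "v (a * b) = v a + v b" if "a \<noteq> 0" "b \<noteq> 0" for a b
    using v that by (auto simp: discrete_valuation_def)
  have add: "min (v a) (v b) \<le> v (a + b)" if "a \<noteq> 0" "b \<noteq> 0" "a + b \<noteq> 0" for a b
    using v that unfolding discrete_valuation_def by blast
  have v1: "v 1 = 0" using mult[of 1 1] by simp
  have vm1: "v (-1) = 0" using mult[of "-1" "-1"] v1 by simp
  have plus: "a + b \<in> V" if "a \<in> V" "b \<in> V" for a b
    using add[of a b] that unfolding V by force
  have times: "a * b \<in> V" if "a \<in> V" "b \<in> V" for a b
    using mult[of a b] that unfolding V by force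
  have "- 1 \<in> V" using vm1 by (simp add: V)
  from times[OF this] have uminus: "- a \<in> V" if "a \<in> V" for a using that by simp
  show "0 \<in> V" "1 \<in> V" by (simp_all add: V v1)
  show "x \<in> V \<Longrightarrow> y \<in> V \<Longrightarrow> x * y \<in> V" by (rule times)
  show "x \<in> V \<Longrightarrow> y \<in> V \<Longrightarrow> x + y \<in> V" by (rule plus)
  show "x - y \<in> V" if "x \<in> V" "y \<in> V" using plus[OF that(1) uminus[OF that(2)]] by simp
qed

lemma uniformizer_nonzero:
  assumes "discrete_valuation_domain V" "uniformizer V p"
  shows "p \<noteq> 0"
proof
  assume "p = 0"
  obtain v where v: "discrete_valuation v" and V: "V = {x. x = 0 \<or> 0 \<le> v x}"
    using assms by (auto simp: discrete_valuation_domain_def)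
  have mult: "v (a * b) = v a + v b" if "a \<noteq> 0" "b \<noteq> 0" for a b
    using v that by (auto simp: discrete_valuation_def)
  have "1 \<in> v ` (UNIV - {0})" using v by (auto simp: discrete_valuation_def)
  then obtain t where t: "t \<noteq> 0" "v t = 1" by (metis DiffE imageE singletonI)
  have "v t + v (inverse t) = 0" using mult[of t "inverse t"] mult[of 1 1] t by simp
  hence "t \<in> {x \<in> V. x = 0 \<or> inverse x \<notin> V}" using t by (auto simp: V)
  hence "t \<in> {p * y | y. y \<in> V}" using assms(2) unfolding uniformizer_def by blast
  thus False using t \<open>p = 0\<close> by auto
qed

lemma char_two_double:
  fixes x :: "'k::field"
  assumes "CHAR('k) = 2"
  shows "x + x = 0"
proof -
  have "(2::'k) = 0" using of_nat_CHAR[where ?'a = 'k] assms by simp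
  thus ?thesis by (metis mult_2 mult_zero_left)
qed

section \<open>Polynomials with values in a submodule\<close>

text \<open>Newton interpolation: dividing by \<open>Y - a\<close> with \<open>a \<in> S\<close> lowers the degree, and on the rest of
  \<open>S\<close> the quotient \<open>(g(b) - g(a)) / (b - a)\<close> still takes its values in \<open>I\<close>.\<close>

lemma coeff_in_submodule:
  fixes g :: "'k::field poly"
  assumes zero: "0 \<in> I" and diff: "\<And>x y. x \<in> I \<Longrightarrow> y \<in> I \<Longrightarrow> x - y \<in> I"
    and smult: "\<And>c x. c \<in> R \<Longrightarrow> x \<in> I \<Longrightarrow> c * x \<in> I"
    and "infinite S" "S \<subseteq> R"
    and "\<And>a b. a \<in> S \<Longrightarrow> b \<in> S \<Longrightarrow> a \<noteq> b \<Longrightarrow> inverse (a - b) \<in> R"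
    and "\<And>a. a \<in> S \<Longrightarrow> poly g a \<in> I"
  shows "coeff g n \<in> I"
  using assms(4-7)
proof (induction "degree g" arbitrary: g S n)
  case 0
  obtain a where "a \<in> S" using \<open>infinite S\<close> by fastforce
  obtain c where g: "g = [:c:]" using 0(1) by (metis degree_eq_zeroE)
  have "c \<in> I" using 0(5)[OF \<open>a \<in> S\<close>] by (simp add: g)
  thus ?case by (cases n) (auto simp: g zero)
next
  case (Suc m)
  obtain a where a: "a \<in> S" using \<open>infinite S\<close> by fastforce
  define h where "h = synthetic_div g a"
  have g: "g = [:- a, 1:] * h + [:poly g a:]"
    unfolding h_def by (rule synthetic_div_correct'[symmetric])
  have "m = degree h" using Suc(2) by (simp add: h_def degree_synthetic_div)
  moreover have "poly h b \<in> I" if b: "b \<in> S - {a}" for b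
  proof -
    have "poly g b = (b - a) * poly h b + poly g a"
      using arg_cong[OF g, of "\<lambda>q. poly q b"] by (simp add: algebra_simps)
    hence "poly h b = inverse (b - a) * (poly g b - poly g a)" using b by simp
    thus ?thesis using b a Suc.prems by (auto intro!: smult diff)
  qed
  ultimately have h: "coeff h k \<in> I" for k
    using Suc.prems by (intro Suc.hyps(1)[of h "S - {a}"]) auto
  have aR: "a \<in> R" and ga: "poly g a \<in> I" using a Suc.prems by auto
  have neg: "- x \<in> I" if "x \<in> I" for x using diff[OF zero that] by simp
  have coeff_diff: "coeff h k - a * coeff h (Suc k) \<in> I" for k
    by (intro diff h smult aR)
  show ?case
  proof (cases n)
    case 0
    have "coeff g n = poly g a - a * coeff h 0"
      using arg_cong[OF g, of "\<lambda>q. coeff q n"] 0 by simp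
    thus ?thesis using diff[OF ga smult[OF aR h]] by simp
  next
    case (Suc k)
    have "coeff g n = coeff h k - a * coeff h (Suc k)"
      using arg_cong[OF g, of "\<lambda>q. coeff q n"] Suc by simp
    thus ?thesis using coeff_diff by simp
  qed
qed

text \<open>Representatives of the residue classes: distinct ones differ by a unit, since the non-units
  are \<open>p V\<close>.\<close>

lemma infinite_unit_differences:
  assumes V: "discrete_valuation_domain V" and p: "uniformizer V p"
    and inf: "infinite (residue_field V p)"
  obtains S where "infinite S" "S \<subseteq> V"
    "\<And>a b. a \<in> S \<Longrightarrow> b \<in> S \<Longrightarrow> a \<noteq> b \<Longrightarrow> inverse (a - b) \<in> V"
proof -
  note cl = dvr_closed[OF V]
  define r where "r = {(x, y). x \<in> V \<and> y \<in> V \<and> x - y \<in> {p * z | z. z \<in> V}}"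
  have "\<exists>x. x \<in> V \<and> c = r `` {x}" if "c \<in> residue_field V p" for c
    using that unfolding residue_field_def r_def[symmetric] quotient_def by blast
  then obtain \<rho> where \<rho>: "\<And>c. c \<in> residue_field V p \<Longrightarrow> \<rho> c \<in> V \<and> c = r `` {\<rho> c}"
    by metis
  define S where "S = \<rho> ` residue_field V p"
  have "inj_on \<rho> (residue_field V p)" using \<rho> by (metis inj_onI)
  hence "infinite S" using inf by (simp add: S_def finite_image_iff)
  moreover have SV: "S \<subseteq> V" using \<rho> by (auto simp: S_def)
  moreover have "inverse (a - b) \<in> V" if ab: "a \<in> S" "b \<in> S" "a \<noteq> b" for a b
  proof (rule ccontr)
    assume "inverse (a - b) \<notin> V"
    moreover have inV: "a \<in> V" "b \<in> V" using ab SV by auto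
    moreover have "a - b \<in> V" using inV by (intro cl)
    ultimately have "a - b \<in> {p * y | y. y \<in> V}"
      using p unfolding uniformizer_def by blast
    then obtain y where y: "y \<in> V" "a - b = p * y" by auto
    have "r `` {a} = r `` {b}"
    proof (intro set_eqI)
      fix x
      have 1: "a - x = p * (y + z)" if "b - x = p * z" for z
        using y(2) that by (metis add_diff_cancel_left' diff_add_cancel diff_diff_eq2 distrib_left
          add_diff_eq)
      have 2: "b - x = p * (z - y)" if "a - x = p * z" for z
        using y(2) that by (simp add: right_diff_distrib algebra_simps)
      show "x \<in> r `` {a} \<longleftrightarrow> x \<in> r `` {b}"
        using 1 2 y(1) inV cl(4,5) unfolding r_def by (simp, metis)
    qed
    moreover from ab obtain c d where
      "c \<in> residue_field V p" "d \<in> residue_field V p" "a = \<rho> c" "b = \<rho> d"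
      by (auto simp: S_def)
    ultimately have "c = d" using \<rho> by metis
    thus False using ab \<open>a = \<rho> c\<close> \<open>b = \<rho> d\<close> by simp
  qed
  ultimately show ?thesis by (rule that)
qed

section \<open>The ring \<open>D\<close> and its integer-valued polynomials\<close>

lemma F2_plus_closed:
  fixes V :: "'k::field set"
  assumes V: "discrete_valuation_domain V" and p: "uniformizer V p" and char: "CHAR('k) = 2"
  shows "0 \<in> F2_plus V p" "1 \<in> F2_plus V p" "F2_plus V p \<subseteq> V"
    "x \<in> F2_plus V p \<Longrightarrow> y \<in> F2_plus V p \<Longrightarrow> x - y \<in> F2_plus V p"
    "x \<in> F2_plus V p \<Longrightarrow> y \<in> F2_plus V p \<Longrightarrow> x * y \<in> F2_plus V p"
    "x \<in> F2_plus V p \<Longrightarrow> y \<in> V \<Longrightarrow> x + p * y \<in> F2_plus V p"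
proof -
  note cl = dvr_closed[OF V]
  have pV: "p \<in> V" using p by (simp add: uniformizer_def)
  have I: "e + p * a \<in> F2_plus V p" if "e \<in> {0, 1}" "a \<in> V" for e a
    using that unfolding F2_plus_def by blast
  have E: "\<exists>e a. e \<in> {0, 1} \<and> a \<in> V \<and> z = e + p * a" if "z \<in> F2_plus V p" for z
    using that unfolding F2_plus_def by blast
  show "0 \<in> F2_plus V p" using I[of 0 0] cl by simp
  show "1 \<in> F2_plus V p" using I[of 1 0] cl by simp
  show "F2_plus V p \<subseteq> V" unfolding F2_plus_def using cl pV by auto
  have m1: "(- 1 :: 'k) = 1"
    using char_two_double[OF char, of 1] by (metis neg_eq_iff_add_eq_0)
  show "x - y \<in> F2_plus V p" if xy: "x \<in> F2_plus V p" "y \<in> F2_plus V p"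
  proof -
    obtain e a e' a' where *: "e \<in> {0, 1}" "a \<in> V" "x = e + p * a"
      "e' \<in> {0, 1}" "a' \<in> V" "y = e' + p * a'"
      using E xy by meson
    have "x - y = (e - e') + p * (a - a')" using * by (simp add: algebra_simps)
    moreover have "e - e' \<in> {0, 1}" using * m1 by auto
    moreover have "a - a' \<in> V" using * cl by auto
    ultimately show ?thesis using I by metis
  qed
  show "x * y \<in> F2_plus V p" if xy: "x \<in> F2_plus V p" "y \<in> F2_plus V p"
  proof -
    obtain e a e' a' where *: "e \<in> {0, 1}" "a \<in> V" "x = e + p * a"
      "e' \<in> {0, 1}" "a' \<in> V" "y = e' + p * a'"
      using E xy by meson
    have "x * y = (e * e') + p * (e * a' + e' * a + p * a * a')"
      using * by (simp add: algebra_simps)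
    moreover have "e * e' \<in> {0, 1}" using * by auto
    moreover have "e \<in> V" "e' \<in> V" using * cl by auto
    hence "e * a' + e' * a + p * a * a' \<in> V" using * cl pV by simp
    ultimately show ?thesis using I by metis
  qed
  show "x + p * y \<in> F2_plus V p" if x: "x \<in> F2_plus V p" and y: "y \<in> V"
  proof -
    obtain e a where *: "e \<in> {0, 1}" "a \<in> V" "x = e + p * a" using E x by meson
    have "x + p * y = e + p * (a + y)" using * by (simp add: algebra_simps)
    thus ?thesis using I[OF *(1) cl(5)[OF *(2) y]] by simp
  qed
qed

lemma F2_plus_square_add_self:
  fixes V :: "'k::field set"
  assumes V: "discrete_valuation_domain V" and p: "uniformizer V p" and char: "CHAR('k) = 2"
    and x: "x \<in> F2_plus V p"
  obtains y where "y \<in> V" "x\<^sup>2 + x = p * y"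
proof -
  note cl = dvr_closed[OF V]
  have pV: "p \<in> V" using p by (simp add: uniformizer_def)
  note two = char_two_double[OF char]
  obtain e a where *: "e \<in> {0, 1}" "a \<in> V" "x = e + p * a"
    using x unfolding F2_plus_def by blast
  have "e\<^sup>2 + e = 0" using * two[of 1] by auto
  moreover have "x\<^sup>2 + x = (e\<^sup>2 + e) + (e * p * a + e * p * a) + p * (p * a * a + a)"
    using * by (simp add: power2_eq_square algebra_simps)
  ultimately have "x\<^sup>2 + x = p * (p * a * a + a)" by (simp add: two)
  moreover have "p * a * a + a \<in> V" using * cl pV by simp
  ultimately show ?thesis using that by blast
qed

text \<open>In general \<open>f\<close> itself does not have coefficients in \<open>V\<close>, as \<open>(Z\<^sup>2 + Z)\<^sup>2 / p\<close> shows; but its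
  derivative is controlled. Passing from \<open>f\<close> to \<open>f\<^sup>2 + f\<close> moves the values from \<open>D\<close> to the
  \<open>V\<close>-submodule \<open>p V\<close>, and does not change the derivative.\<close>

lemma pderiv_Int1_in_V:
  fixes V :: "'k::field set"
  assumes V: "discrete_valuation_domain V" and p: "uniformizer V p" and char: "CHAR('k) = 2"
    and inf: "infinite (residue_field V p)"
    and f: "f \<in> Int1 (F2_plus V p)" and d: "d \<in> F2_plus V p"
  shows "poly (pderiv f) d \<in> V"
proof -
  note cl = dvr_closed[OF V]
  define I where "I = {p * y | y. y \<in> V}"
  obtain S where S: "infinite S" "S \<subseteq> V"
    "\<And>a b. a \<in> S \<Longrightarrow> b \<in> S \<Longrightarrow> a \<noteq> b \<Longrightarrow> inverse (a - b) \<in> V"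
    using infinite_unit_differences[OF V p inf] by metis
  define q where "q = pcompose (f * f + f) [:d, p:]"
  have "coeff q 1 \<in> I"
  proof (rule coeff_in_submodule[where R = V and S = S])
    show "0 \<in> I" using cl(1) unfolding I_def by force
    show "x - y \<in> I" if "x \<in> I" "y \<in> I" for x y
      using that cl(4) unfolding I_def by (auto simp: right_diff_distrib[symmetric])
    show "c * x \<in> I" if "c \<in> V" "x \<in> I" for c x
      using that cl(3) unfolding I_def by (auto simp: mult.left_commute)
    show "poly q a \<in> I" if "a \<in> S" for a
    proof -
      have "d + p * a \<in> F2_plus V p"
        using F2_plus_closed(6)[OF V p char d] that S(2) by blast
      hence "poly f (d + p * a) \<in> F2_plus V p" using f by (simp add: Int1_def)
      from F2_plus_square_add_self[OF V p char this] show ?thesis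
        by (auto simp: I_def q_def poly_pcompose power2_eq_square mult.commute[of a])
    qed
  qed (use S in auto)
  moreover have "coeff q 1 = p * poly (pderiv f) d"
  proof -
    have "coeff q 1 = poly (pderiv q) 0" by (simp add: poly_0_coeff_0 coeff_pderiv)
    also have "\<dots> = p * poly (pderiv f) d"
      using char_two_double[OF char, of "poly f d * poly (pderiv f) d"]
      by (simp add: q_def pderiv_pcompose poly_pcompose pderiv_add pderiv_mult pderiv_pCons
          mult.commute)
    finally show ?thesis .
  qed
  ultimately show ?thesis using uniformizer_nonzero[OF V p] by (auto simp: I_def)
qed

section \<open>Jets at the origin\<close>

abbreviation coeff2 :: "'k::field poly poly \<Rightarrow> nat \<Rightarrow> nat \<Rightarrow> 'k" where
  "coeff2 F i j \<equiv> coeff (coeff F j) i"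

text \<open>The pure quadratic terms must stay unrestricted: for \<open>(U\<^sup>2 + U)\<^sup>2 / p \<in> A\<close> the coefficient of
  \<open>U\<^sup>2\<close> is not in \<open>V\<close>.\<close>

definition Vjets :: "'k::field set \<Rightarrow> 'k set \<Rightarrow> 'k poly poly set" where
  "Vjets D V = {F. coeff2 F 0 0 \<in> D \<and> coeff2 F 1 0 \<in> V \<and> coeff2 F 0 1 \<in> V \<and> coeff2 F 1 1 \<in> V}"

lemma coeff2_mult:
  "coeff2 (F * G) 0 0 = coeff2 F 0 0 * coeff2 G 0 0"
  "coeff2 (F * G) 1 0 = coeff2 F 0 0 * coeff2 G 1 0 + coeff2 F 1 0 * coeff2 G 0 0"
  "coeff2 (F * G) 0 1 = coeff2 F 0 0 * coeff2 G 0 1 + coeff2 F 0 1 * coeff2 G 0 0"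
  "coeff2 (F * G) 1 1 = coeff2 F 0 0 * coeff2 G 1 1 + coeff2 F 1 0 * coeff2 G 0 1
     + coeff2 F 0 1 * coeff2 G 1 0 + coeff2 F 1 1 * coeff2 G 0 0"
  by (simp_all add: coeff_mult algebra_simps)

text \<open>The chain rule. Horner's scheme produces \<open>f'(G\<^sub>0\<^sub>0) G\<^sub>1\<^sub>0 G\<^sub>0\<^sub>1\<close> twice in the mixed coefficient,
  once from each order of differentiation; in characteristic 2 the two cancel.\<close>

lemma coeff2_subst2:
  fixes f :: "'k::field poly"
  assumes char: "CHAR('k) = 2"
  shows "coeff2 (subst2 f G) 0 0 = poly f (coeff2 G 0 0)"
    "coeff2 (subst2 f G) 1 0 = poly (pderiv f) (coeff2 G 0 0) * coeff2 G 1 0"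
    "coeff2 (subst2 f G) 0 1 = poly (pderiv f) (coeff2 G 0 0) * coeff2 G 0 1"
    "coeff2 (subst2 f G) 1 1 = poly (pderiv f) (coeff2 G 0 0) * coeff2 G 1 1"
proof -
  define g where "g = coeff2 G 0 0"
  have c0: "const2 0 = (0 :: 'k poly poly)" by (simp add: const2_def)
  have "coeff2 (subst2 f G) 0 0 = poly f g \<and>
    coeff2 (subst2 f G) 1 0 = poly (pderiv f) g * coeff2 G 1 0 \<and>
    coeff2 (subst2 f G) 0 1 = poly (pderiv f) g * coeff2 G 0 1 \<and>
    coeff2 (subst2 f G) 1 1 = poly (pderiv f) g * coeff2 G 1 1"
  proof (induction f)
    case 0
    show ?case by (simp add: subst2_def)
  next
    case (pCons a f)
    have step: "subst2 (pCons a f) G = const2 a + G * subst2 f G"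
      using pCons.hyps by (simp add: subst2_def map_poly_pCons c0)
    have const: "coeff2 (const2 a) 0 0 = a" "coeff2 (const2 a) 1 0 = 0"
      "coeff2 (const2 a) 0 1 = 0" "coeff2 (const2 a) 1 1 = 0"
      by (simp_all add: const2_def)
    show ?case
      unfolding step coeff_add coeff2_mult const g_def[symmetric]
      using pCons.IH char_two_double[OF char, of "poly (pderiv f) g * (coeff2 G 1 0 * coeff2 G 0 1)"]
      by (simp add: pderiv_pCons algebra_simps)
  qed
  thus "coeff2 (subst2 f G) 0 0 = poly f (coeff2 G 0 0)"
    "coeff2 (subst2 f G) 1 0 = poly (pderiv f) (coeff2 G 0 0) * coeff2 G 1 0"
    "coeff2 (subst2 f G) 0 1 = poly (pderiv f) (coeff2 G 0 0) * coeff2 G 0 1"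
    "coeff2 (subst2 f G) 1 1 = poly (pderiv f) (coeff2 G 0 0) * coeff2 G 1 1"
    by (simp_all add: g_def)
qed

lemma adjoin_subset_Vjets:
  fixes V :: "'k::field set"
  assumes V: "discrete_valuation_domain V" and p: "uniformizer V p" and char: "CHAR('k) = 2"
    and S: "S \<subseteq> Vjets (F2_plus V p) V"
  shows "adjoin (F2_plus V p) S \<subseteq> Vjets (F2_plus V p) V"
proof
  note cl = dvr_closed[OF V] and Dcl = F2_plus_closed[OF V p char]
  fix F assume "F \<in> adjoin (F2_plus V p) S"
  thus "F \<in> Vjets (F2_plus V p) V"
  proof induction
    case (const c)
    thus ?case using cl by (simp add: Vjets_def const2_def)
  next
    case (gen F)
    thus ?case using S by auto
  next
    case (diff F G)
    thus ?case using cl Dcl by (simp add: Vjets_def)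
  next
    case (mult F G)
    hence "coeff2 F 0 0 \<in> V" "coeff2 G 0 0 \<in> V" using Dcl(3) by (auto simp: Vjets_def)
    with mult show ?case
      unfolding Vjets_def mem_Collect_eq coeff2_mult by (intro conjI cl Dcl) auto
  qed
qed

lemma A_union_subset_Vjets:
  fixes V :: "'k::field set"
  assumes V: "discrete_valuation_domain V" and p: "uniformizer V p" and char: "CHAR('k) = 2"
    and inf: "infinite (residue_field V p)"
  shows "A_union (F2_plus V p) \<subseteq> Vjets (F2_plus V p) V"
proof -
  note cl = dvr_closed[OF V] and Dcl = F2_plus_closed[OF V p char]
  have "A_ring (F2_plus V p) r \<subseteq> Vjets (F2_plus V p) V" for r
  proof (induction r)
    case 0
    have "{varU, varW} \<subseteq> Vjets (F2_plus V p) V"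
      using cl Dcl by (simp add: Vjets_def varU_def varW_def)
    thus ?case using adjoin_subset_Vjets[OF V p char] by simp
  next
    case (Suc r)
    have "subst2 f G \<in> Vjets (F2_plus V p) V"
      if f: "f \<in> Int1 (F2_plus V p)" and G: "G \<in> A_ring (F2_plus V p) r" for f G
    proof -
      have G': "G \<in> Vjets (F2_plus V p) V" using G Suc by blast
      hence G0: "coeff2 G 0 0 \<in> F2_plus V p" by (simp add: Vjets_def)
      have "poly (pderiv f) (coeff2 G 0 0) \<in> V"
        by (rule pderiv_Int1_in_V[OF V p char inf f G0])
      moreover have "poly f (coeff2 G 0 0) \<in> F2_plus V p" using f G0 by (simp add: Int1_def)
      ultimately show ?thesis
        using G' cl(3) unfolding Vjets_def mem_Collect_eq coeff2_subst2[OF char] by blast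
    qed
    hence "A_ring (F2_plus V p) r \<union>
      {subst2 f G | f G. f \<in> Int1 (F2_plus V p) \<and> G \<in> A_ring (F2_plus V p) r}
      \<subseteq> Vjets (F2_plus V p) V"
      using Suc by blast
    thus ?case using adjoin_subset_Vjets[OF V p char] by simp
  qed
  thus ?thesis by (auto simp: A_union_def)
qed

theorem proposition4p2:
  fixes V D :: "'k::field set" and p :: 'k and P :: "'k poly poly"
  assumes "discrete_valuation_domain V"
    and "CHAR('k) = 2"
    and "uniformizer V p"
    and "infinite (residue_field V p)"
    and "D = F2_plus V p"
    and "P = const2 (1 / p) * ((varU ^ 2 + varU) * (varW ^ 2 + varW))"
  shows "P \<in> Int2 D \<and> P \<notin> A_union D"
proof
  note V = assms(1) and char = assms(2) and p = assms(3)
  note cl = dvr_closed[OF V]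
  have p0: "p \<noteq> 0" by (rule uniformizer_nonzero[OF V p])
  have eval: "eval2 P u w = (1 / p) * ((u\<^sup>2 + u) * (w\<^sup>2 + w))" for u w
    by (simp add: assms(6) eval2_def const2_def varU_def varW_def power2_eq_square
        add_divide_distrib algebra_simps)
  show "P \<in> Int2 D"
    unfolding Int2_def mem_Collect_eq
  proof (intro ballI)
    fix u w assume "u \<in> D" "w \<in> D"
    then obtain a b where "a \<in> V" "u\<^sup>2 + u = p * a" "b \<in> V" "w\<^sup>2 + w = p * b"
      using F2_plus_square_add_self[OF V p char] assms(5) by metis
    hence "eval2 P u w = 0 + p * (a * b)" "a * b \<in> V" using p0 cl(3) by (simp_all add: eval)
    thus "eval2 P u w \<in> D"
      using F2_plus_closed(6)[OF V p char F2_plus_closed(1)[OF V p char]] assms(5) by metis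
  qed
  show "P \<notin> A_union D"
  proof
    assume "P \<in> A_union D"
    hence "coeff2 P 1 1 \<in> V"
      using A_union_subset_Vjets[OF V p char assms(4)] assms(5) by (auto simp: Vjets_def)
    moreover have "coeff2 P 1 1 = inverse p"
      by (simp add: assms(6) const2_def varU_def varW_def power2_eq_square coeff_mult
          inverse_eq_divide)
    ultimately have "inverse p \<in> V" by simp
    moreover have "p \<in> {p * y | y. y \<in> V}" using cl(2) by force
    hence "p \<in> {x \<in> V. x = 0 \<or> inverse x \<notin> V}" using p by (simp add: uniformizer_def)
    ultimately show False using p0 by simp
  qed
qed

end
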